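(* Let $I\subset\mathbb R$ be an interval, let $(\gamma_h,\gamma_h^d):I\to\Delta_1$ be a spacelike Legendre curve with curvature $(m_h,n_h)$ and $\gamma_h^s=\gamma_h\wedge\gamma_h^d$, and for a choice of sign let $\mathcal{HP}^\pm_{\lambda_\pm}=\gamma_h+\lambda_\pm\gamma_h^d+\frac{\lambda_\pm^2}{2}(\gamma_h\pm\gamma_h^s)$ be a hyperbolic horocyclic parallel of $(\gamma_h,\gamma_h^d)$, where $\lambda_\pm$ is a solution of $\dot\lambda_\pm=\mp\left(\frac{\lambda_\pm^2n_h}{2}+\lambda_\pm m_h\right)$. Let $\nu^\pm_{\mathcal{HP}}=\lambda_\pm\gamma_h+\gamma_h^d\pm\lambda_\pm\gamma_h^s$ and $\mu^\pm_{\mathcal{HP}}=\mathcal{HP}^\pm_{\lambda_\pm}\wedge\nu^\pm_{\mathcal{HP}}$. Then $$(\mathcal{HP}^\pm_{\lambda_\pm},\nu^\pm_{\mathcal{HP}},\mu^\pm_{\mathcal{HP}})^T=N_2^\mp(\lambda_\pm)\,(\gamma_h,\gamma_h^d,\gamma_h^s)^T .$$ That is, $(\mathcal{HP}^\pm_{\lambda_\pm}(t),\nu^\pm_{\mathcal{HP}}(t),\mu^\pm_{\mathcal{HP}}(t))$ is obtained by applying a null rotation around the $(\gamma_h\mp\gamma_h^s)$-direction with angle $\lambda_\pm(t)$ to $(\gamma_h(t),\gamma_h^d(t),\gamma_h^s(t))$, for all $t\in I$.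
   Context: All maps are $C^\infty$. $\mathbb R^3_1$ is $\mathbb R^3$ with $\langle x,y\rangle=-x_1y_1+x_2y_2+x_3y_3$ and $x\wedge y=(-(x_2y_3-x_3y_2),\,x_3y_1-x_1y_3,\,x_1y_2-x_2y_1)$. $H^2=\{x:\langle x,x\rangle=-1\}$, $S^2_1=\{x:\langle x,x\rangle=1\}$, $\Delta_1=\{(v,w)\in H^2\times S_1^2:\langle v,w\rangle=0\}$. A spacelike Legendre curve in $\Delta_1$ is a smooth map $(\gamma_h,\gamma_h^d):I\to\Delta_1$ with $\langle\dot\gamma_h,\gamma_h^d\rangle=0$ on $I$. Its curvature $(m_h,n_h)$ is defined by $\dot\gamma_h=m_h\gamma_h^s$, $\dot\gamma_h^d=n_h\gamma_h^s$, $\dot\gamma_h^s=m_h\gamma_h-n_h\gamma_h^d$ with $\gamma_h^s=\gamma_h\wedge\gamma_h^d$. If the solution $\lambda_\pm$ is not global, $I$ is replaced by a subinterval on which it exists. Matrices: $N_2^\pm(\phi)=\begin{pmatrix}1+\frac{\phi^2}{2}&\phi&\mp\frac{\phi^2}{2}\\ \phi&1&\mp\phi\\ \pm\frac{\phi^2}{2}&\pm\phi&1-\frac{\phi^2}{2}\end{pmatrix}$. With respect to a pseudo-orthonormal basis $(x_1,x_2,x_3)$ with $x_1$ timelike, $N_2^\pm(\phi)$ is called the matrix of the null rotation around the $(x_1\pm x_3)$-direction with angle $\phi$. For a $3\times3$ matrix $A=(a_{ij})$ and vectors $v_1,v_2,v_3$, $A(v_1,v_2,v_3)^T$ denotes the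 triple whose $i$-th entry is $\sum_j a_{ij}v_j$. Upper signs go together and lower signs go together. *)

theory Defs
  imports "HOL-Analysis.Analysis"
begin

text \<open>Derivatives are taken within the interval, hence one-sided at an endpoint belonging to it.
  The sequence \<open>D\<close> lists the derivatives of all orders.\<close>

definition smooth_on :: "real set \<Rightarrow> (real \<Rightarrow> 'a::real_normed_vector) \<Rightarrow> bool" where
  "smooth_on I f \<longleftrightarrow>
     (\<exists>D. D 0 = f \<and>
          (\<forall>n. \<forall>t\<in>I. (D n has_vector_derivative D (Suc n) t) (at t within I)))"

definition mink :: "real^3 \<Rightarrow> real^3 \<Rightarrow> real" where
  "mink x y = - (x$1 * y$1) + x$2 * y$2 + x$3 * y$3"

definition wedge :: "real^3 \<Rightarrow> real^3 \<Rightarrow> real^3" where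
  "wedge x y = vector [- (x$2 * y$3 - x$3 * y$2), x$3 * y$1 - x$1 * y$3, x$1 * y$2 - x$2 * y$1]"

definition hyperbolic_plane :: "(real^3) set" where
  "hyperbolic_plane = {x. mink x x = -1}"

definition de_Sitter :: "(real^3) set" where
  "de_Sitter = {x. mink x x = 1}"

definition Delta1 :: "((real^3) \<times> (real^3)) set" where
  "Delta1 = {(v, w). v \<in> hyperbolic_plane \<and> w \<in> de_Sitter \<and> mink v w = 0}"

definition spacelike_Legendre_curve ::
    "real set \<Rightarrow> (real \<Rightarrow> real^3) \<Rightarrow> (real \<Rightarrow> real^3) \<Rightarrow> bool" where
  "spacelike_Legendre_curve I \<gamma> \<gamma>d \<longleftrightarrow>
     smooth_on I \<gamma> \<and> smooth_on I \<gamma>d \<and>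
     (\<forall>t\<in>I. (\<gamma> t, \<gamma>d t) \<in> Delta1) \<and>
     (\<forall>t\<in>I. mink (vector_derivative \<gamma> (at t within I)) (\<gamma>d t) = 0)"

definition gamma_s :: "(real \<Rightarrow> real^3) \<Rightarrow> (real \<Rightarrow> real^3) \<Rightarrow> real \<Rightarrow> real^3" where
  "gamma_s \<gamma> \<gamma>d t = wedge (\<gamma> t) (\<gamma>d t)"

definition has_curvature ::
    "real set \<Rightarrow> (real \<Rightarrow> real^3) \<Rightarrow> (real \<Rightarrow> real^3) \<Rightarrow> (real \<Rightarrow> real) \<Rightarrow> (real \<Rightarrow> real) \<Rightarrow> bool" where
  "has_curvature I \<gamma> \<gamma>d m n \<longleftrightarrow>
     (\<forall>t\<in>I.
        (\<gamma> has_vector_derivative m t *\<^sub>R gamma_s \<gamma> \<gamma>d t) (at t within I) \<and>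
        (\<gamma>d has_vector_derivative n t *\<^sub>R gamma_s \<gamma> \<gamma>d t) (at t within I) \<and>
        (gamma_s \<gamma> \<gamma>d has_vector_derivative m t *\<^sub>R \<gamma> t - n t *\<^sub>R \<gamma>d t) (at t within I))"

text \<open>Below, \<open>s = 1\<close> stands for the upper and \<open>s = -1\<close> for the lower signs throughout.\<close>

definition horocyclic_solution ::
    "real \<Rightarrow> real set \<Rightarrow> (real \<Rightarrow> real) \<Rightarrow> (real \<Rightarrow> real) \<Rightarrow> (real \<Rightarrow> real) \<Rightarrow> bool" where
  "horocyclic_solution s I m n l \<longleftrightarrow>
     smooth_on I l \<and>
     (\<forall>t\<in>I. (l has_real_derivative - s * ((l t)\<^sup>2 * n t / 2 + l t * m t)) (at t within I))"

definition horocyclic_parallel ::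
    "real \<Rightarrow> (real \<Rightarrow> real^3) \<Rightarrow> (real \<Rightarrow> real^3) \<Rightarrow> (real \<Rightarrow> real) \<Rightarrow> real \<Rightarrow> real^3" where
  "horocyclic_parallel s \<gamma> \<gamma>d l t =
     \<gamma> t + l t *\<^sub>R \<gamma>d t + ((l t)\<^sup>2 / 2) *\<^sub>R (\<gamma> t + s *\<^sub>R gamma_s \<gamma> \<gamma>d t)"

definition nu_HP ::
    "real \<Rightarrow> (real \<Rightarrow> real^3) \<Rightarrow> (real \<Rightarrow> real^3) \<Rightarrow> (real \<Rightarrow> real) \<Rightarrow> real \<Rightarrow> real^3" where
  "nu_HP s \<gamma> \<gamma>d l t = l t *\<^sub>R \<gamma> t + \<gamma>d t + (s * l t) *\<^sub>R gamma_s \<gamma> \<gamma>d t"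

definition mu_HP ::
    "real \<Rightarrow> (real \<Rightarrow> real^3) \<Rightarrow> (real \<Rightarrow> real^3) \<Rightarrow> (real \<Rightarrow> real) \<Rightarrow> real \<Rightarrow> real^3" where
  "mu_HP s \<gamma> \<gamma>d l t = wedge (horocyclic_parallel s \<gamma> \<gamma>d l t) (nu_HP s \<gamma> \<gamma>d l t)"

definition N2 :: "real \<Rightarrow> real \<Rightarrow> real^3^3" where
  "N2 s \<phi> = vector
     [vector [1 + \<phi>\<^sup>2 / 2, \<phi>, - s * \<phi>\<^sup>2 / 2],
      vector [\<phi>, 1, - s * \<phi>],
      vector [s * \<phi>\<^sup>2 / 2, s * \<phi>, 1 - \<phi>\<^sup>2 / 2]]"

text \<open>A triple of vectors is a vector of vectors; the matrix combines its members.\<close>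

definition matrix_on_triple :: "real^3^3 \<Rightarrow> (real^3)^3 \<Rightarrow> (real^3)^3" where
  "matrix_on_triple A v = (\<chi> i. \<Sum>j\<in>UNIV. A$i$j *\<^sub>R v$j)"

definition pseudo_orthonormal_basis :: "(real^3)^3 \<Rightarrow> bool" where
  "pseudo_orthonormal_basis x \<longleftrightarrow>
     independent {x$1, x$2, x$3} \<and> span {x$1, x$2, x$3} = UNIV \<and>
     (\<forall>i j. mink (x$i) (x$j) = (if i \<noteq> j then 0 else if i = 1 then -1 else 1))"

definition null_rotation_matrix :: "(real^3)^3 \<Rightarrow> real^3 \<Rightarrow> real \<Rightarrow> real^3^3 \<Rightarrow> bool" where
  "null_rotation_matrix x d \<phi> A \<longleftrightarrow>
     pseudo_orthonormal_basis x \<and>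
     (\<exists>s\<in>{1, -1}. d = x$1 + s *\<^sub>R x$3 \<and> A = N2 s \<phi>)"

text \<open>Pitfall: the direction refers to the action of the matrix on coordinate columns with respect
  to the basis \<open>x\<close>, where \<open>N2 s \<phi>\<close> fixes \<open>x$1 + s *\<^sub>R x$3\<close>. The triple \<open>x\<close> itself is transformed
  through the rows, and the linear map sending each \<open>x$i\<close> to \<open>y$i\<close> has the transposed matrix,
  which fixes \<open>x$1 - s *\<^sub>R x$3\<close> instead.\<close>

definition obtained_by_null_rotation :: "(real^3)^3 \<Rightarrow> real^3 \<Rightarrow> real \<Rightarrow> (real^3)^3 \<Rightarrow> bool" where
  "obtained_by_null_rotation x d \<phi> y \<longleftrightarrow>
     (\<exists>A. null_rotation_matrix x d \<phi> A \<and> y = matrix_on_triple A x)"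

end

theory Submission imports Defs begin

text \<open>The statement is pointwise in \<open>t\<close>. Membership in \<open>\<Delta>\<^sub>1\<close> makes \<open>\<gamma>\<close>, \<open>\<gamma>\<^sup>d\<close> and
  \<open>\<gamma>\<^sup>s = \<gamma> \<and> \<gamma>\<^sup>d\<close> a pseudo-orthonormal basis, and the double product formula
  \<open>wedge_wedge\<close> gives its multiplication table \<open>\<gamma> \<and> \<gamma>\<^sup>s = - \<gamma>\<^sup>d\<close>, \<open>\<gamma>\<^sup>d \<and> \<gamma>\<^sup>s = - \<gamma>\<close>. The first
  two rows of the matrix are read off from the definitions of the parallel and of its normal; the
  third comes from multiplying these two out with the table (\<open>wedge_horocyclic_frame\<close>), where
  the coefficient of \<open>\<gamma>\<^sup>s\<close>, for instance, is \<open>(1 + l\<^sup>2 / 2) - l\<^sup>2 = 1 - l\<^sup>2 / 2\<close>.\<close>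

lemma mink_commute: "mink x y = mink y x"
  by (simp add: mink_def mult.commute)

text \<open>A vector in the span of vectors orthogonal to it is orthogonal to itself, hence null; so
  orthogonality and the absence of null vectors force independence, although the form is
  indefinite.\<close>

lemma independent_if_mink_orthogonal:
  assumes nonnull: "\<And>x. x \<in> B \<Longrightarrow> mink x x \<noteq> 0"
    and orth: "\<And>x y. x \<in> B \<Longrightarrow> y \<in> B \<Longrightarrow> x \<noteq> y \<Longrightarrow> mink x y = 0"
  shows "independent B"
proof
  assume "dependent B"
  then obtain x where x: "x \<in> B" "x \<in> span (B - {x})"
    by (auto simp: dependent_def)
  have "subspace {y. mink x y = 0}"
    by (auto intro!: subspaceI simp: mink_def algebra_simps simp flip: distrib_left)
  then have "span (B - {x}) \<subseteq> {y. mink x y = 0}"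
    using orth x(1) by (intro span_minimal) auto
  with x nonnull show False by auto
qed

text \<open>The Lorentzian counterpart of the expansion of an iterated cross product, with the opposite
  sign.\<close>

lemma wedge_wedge: "wedge x (wedge y z) = mink x y *\<^sub>R z - mink x z *\<^sub>R y"
  by (simp add: vec_eq_iff forall_3 wedge_def mink_def algebra_simps)

lemma wedge_self: "wedge x x = 0"
  by (simp add: vec_eq_iff forall_3 wedge_def)

lemma wedge_anticommute: "wedge x y = - wedge y x"
  by (simp add: vec_eq_iff forall_3 wedge_def)

lemma wedge_add_left: "wedge (x + y) z = wedge x z + wedge y z"
  by (simp add: vec_eq_iff forall_3 wedge_def algebra_simps)

lemma wedge_add_right: "wedge x (y + z) = wedge x y + wedge x z"
  by (simp add: vec_eq_iff forall_3 wedge_def algebra_simps)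

lemma wedge_scaleR_left: "wedge (a *\<^sub>R x) y = a *\<^sub>R wedge x y"
  by (simp add: vec_eq_iff forall_3 wedge_def algebra_simps)

lemma wedge_scaleR_right: "wedge x (a *\<^sub>R y) = a *\<^sub>R wedge x y"
  by (simp add: vec_eq_iff forall_3 wedge_def algebra_simps)

lemma mink_wedge_left: "mink x (wedge x y) = 0"
  by (simp add: wedge_def mink_def algebra_simps)

lemma mink_wedge_right: "mink y (wedge x y) = 0"
  by (simp add: wedge_def mink_def algebra_simps)

text \<open>Lagrange's identity, with the sign reversed by the signature: the product of a timelike and
  an orthogonal spacelike unit vector is spacelike.\<close>

lemma mink_wedge_wedge:
  "mink (wedge x y) (wedge x y) = (mink x y)\<^sup>2 - mink x x * mink y y"
  by (simp add: wedge_def mink_def algebra_simps power2_eq_square)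

text \<open>By Lagrange's identity the Gram matrix is diagonal with entries \<open>-1, 1, 1\<close>, so the three
  vectors are distinct and independent, and they span by dimension.\<close>

lemma pseudo_orthonormal_basis_wedge:
  assumes "(v, w) \<in> Delta1"
  shows "pseudo_orthonormal_basis (vector [v, w, wedge v w])"
proof -
  have vv: "mink v v = - 1" and ww: "mink w w = 1" and vw: "mink v w = 0"
    using assms by (auto simp: Delta1_def hyperbolic_plane_def de_Sitter_def)
  have ee: "mink (wedge v w) (wedge v w) = 1"
    by (simp add: mink_wedge_wedge vv ww vw)
  have wv: "mink w v = 0" and ev: "mink (wedge v w) v = 0" and ew: "mink (wedge v w) w = 0"
    using vw by (simp_all add: mink_commute[of w v] mink_commute[of "wedge v w"]
        mink_wedge_left mink_wedge_right)
  note gram = vv ww ee vw wv ev ew mink_wedge_left mink_wedge_right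
  have indep: "independent {v, w, wedge v w}"
    by (rule independent_if_mink_orthogonal) (auto simp: gram)
  have "v \<noteq> w" "v \<noteq> wedge v w" "w \<noteq> wedge v w"
    using vv ww ee vw ev ew by auto
  then have "card {v, w, wedge v w} = 3" by simp
  then have "UNIV \<subseteq> span {v, w, wedge v w}"
    using indep by (intro card_ge_dim_independent) (auto simp: dim_UNIV)
  then show ?thesis
    using indep by (auto simp: pseudo_orthonormal_basis_def forall_3 gram)
qed

text \<open>The factors are a horocyclic parallel and its normal at one point. Multiplied out with the
  table of the basis, the terms cubic in \<open>l\<close> cancel in the coefficient of \<open>w\<close>.\<close>

lemma wedge_horocyclic_frame:
  fixes l s :: real
  assumes "(v, w) \<in> Delta1"
  defines "e \<equiv> wedge v w"
  shows "wedge (v + l *\<^sub>R w + (l\<^sup>2 / 2) *\<^sub>R (v + s *\<^sub>R e)) (l *\<^sub>R v + w + (s * l) *\<^sub>R e)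
    = (- s * l\<^sup>2 / 2) *\<^sub>R v + (- s * l) *\<^sub>R w + (1 - l\<^sup>2 / 2) *\<^sub>R e"
proof -
  have vv: "mink v v = - 1" and ww: "mink w w = 1" and vw: "mink v w = 0"
    using assms by (auto simp: Delta1_def hyperbolic_plane_def de_Sitter_def)
  have ve: "wedge v e = - w"
    by (simp add: e_def wedge_wedge vv vw)
  have we: "wedge w e = - v"
    by (simp add: e_def wedge_wedge ww vw mink_commute[of w v])
  have table: "wedge v w = e" "wedge w v = - e" "wedge e v = w" "wedge e w = v"
    using ve we wedge_anticommute[of w v] wedge_anticommute[of e v] wedge_anticommute[of e w]
    by (simp_all add: e_def)
  show ?thesis
    by (simp add: wedge_add_left wedge_add_right wedge_scaleR_left wedge_scaleR_right wedge_self
        table ve we vec_eq_iff forall_3 field_simps power2_eq_square)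
qed

text \<open>The direction is the one that the matrix fixes as an operator on coordinate columns; with the
  opposite sign of \<open>s\<close> in \<open>N2\<close> it is \<open>\<gamma> - s *\<^sub>R \<gamma>\<^sup>s\<close>.\<close>

theorem proposition3p28:
  fixes I :: "real set"
    and \<gamma> \<gamma>d :: "real \<Rightarrow> real^3"
    and m n l :: "real \<Rightarrow> real"
    and s :: real
  assumes "is_interval I"
    and "spacelike_Legendre_curve I \<gamma> \<gamma>d"
    and "has_curvature I \<gamma> \<gamma>d m n"
    and "s \<in> {1, -1}"
    and "horocyclic_solution s I m n l"
  shows "\<forall>t\<in>I.
      vector [horocyclic_parallel s \<gamma> \<gamma>d l t, nu_HP s \<gamma> \<gamma>d l t, mu_HP s \<gamma> \<gamma>d l t]
        = matrix_on_triple (N2 (- s) (l t)) (vector [\<gamma> t, \<gamma>d t, gamma_s \<gamma> \<gamma>d t])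
    \<and> obtained_by_null_rotation
        (vector [\<gamma> t, \<gamma>d t, gamma_s \<gamma> \<gamma>d t])
        (\<gamma> t - s *\<^sub>R gamma_s \<gamma> \<gamma>d t)
        (l t)
        (vector [horocyclic_parallel s \<gamma> \<gamma>d l t, nu_HP s \<gamma> \<gamma>d l t, mu_HP s \<gamma> \<gamma>d l t])"
proof
  fix t assume "t \<in> I"
  then have D: "(\<gamma> t, \<gamma>d t) \<in> Delta1"
    using assms(2) by (simp add: spacelike_Legendre_curve_def)
  have s: "s = 1 \<or> s = - 1"
    using assms(4) by auto
  let ?x = "vector [\<gamma> t, \<gamma>d t, gamma_s \<gamma> \<gamma>d t] :: (real^3)^3"
  let ?y = "vector [horocyclic_parallel s \<gamma> \<gamma>d l t, nu_HP s \<gamma> \<gamma>d l t, mu_HP s \<gamma> \<gamma>d l t]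
      :: (real^3)^3"
  have mu: "mu_HP s \<gamma> \<gamma>d l t = (- s * (l t)\<^sup>2 / 2) *\<^sub>R \<gamma> t + (- s * l t) *\<^sub>R \<gamma>d t
      + (1 - (l t)\<^sup>2 / 2) *\<^sub>R gamma_s \<gamma> \<gamma>d t"
    unfolding mu_HP_def horocyclic_parallel_def nu_HP_def gamma_s_def
    by (rule wedge_horocyclic_frame[OF D])
  have eq: "?y = matrix_on_triple (N2 (- s) (l t)) ?x"
    unfolding vec_eq_iff[of ?y] forall_3
    by (simp add: matrix_on_triple_def sum_3 N2_def mu
        horocyclic_parallel_def nu_HP_def algebra_simps)
  have "pseudo_orthonormal_basis ?x"
    using pseudo_orthonormal_basis_wedge[OF D] by (simp add: gamma_s_def)
  then have "null_rotation_matrix ?x (\<gamma> t - s *\<^sub>R gamma_s \<gamma> \<gamma>d t) (l t) (N2 (- s) (l t))"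
    using s by (auto simp: null_rotation_matrix_def)
  with eq show "?y = matrix_on_triple (N2 (- s) (l t)) ?x \<and>
      obtained_by_null_rotation ?x (\<gamma> t - s *\<^sub>R gamma_s \<gamma> \<gamma>d t) (l t) ?y"
    by (auto simp: obtained_by_null_rotation_def)
qed

end
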